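(* The system of difference equations $$x_{n+1}=\frac{-1}{y_n(x_{n-1}-1)+1},\qquad y_{n+1}=\frac{-1}{x_n(y_{n-1}-1)+1},\qquad n=0,1,2,\dots,$$ has a unique negative equilibrium point, namely $(\overline{x},\overline{y})=(d,d)$ with $$d=\frac{1+\sqrt[3]{3\sqrt{33}-17}-\sqrt[3]{3\sqrt{33}+17}}{3},$$ and $(d,d)$ is locally asymptotically stable.
   Context: The number $d$ is the unique real root of $x^3-x^2+x+1=0$. Initial values $x_{-1},x_0,y_{-1},y_0$ are real. An equilibrium point is a point $(\overline{x},\overline{y})\in\mathbb{R}^2$ such that the constant sequences $x_n=\overline{x}$, $y_n=\overline{y}$ satisfy the system; it is negative if $\overline{x}<0$ and $\overline{y}<0$. An equilibrium point $(\overline{x},\overline{y})$ is stable if for every $\varepsilon>0$ there exists $\delta>0$ such that whenever $|x_{-i}-\overline{x}|<\delta$ and $|y_{-i}-\overline{y}|<\delta$ for $i=0,1$, the solution is well defined (no denominator vanishes) and satisfies $|x_n-\overline{x}|<\varepsilon$, $|y_n-\overline{y}|<\varepsilon$ for all $n\ge 0$. It is locally asymptotically stable if it is stable and in addition there exists $\gamma>0$ such that whenever $|x_{-i}-\overline{x}|<\gamma$ and $|y_{-i}-\overline{y}|<\gamma$ for $i=0,1$, one has $(x_n,y_n)\to(\overline{x},\overline{y})$ as $n\to\infty$. *)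

theory Defs
  imports "HOL-Analysis.Analysis"
begin

definition d :: real where
  "d = (THE x. x ^ 3 - x ^ 2 + x + 1 = 0)"

text \<open>The following lemma shows that the definite description above is proper.\<close>

lemma ex1_cubic_root: "\<exists>!x::real. x ^ 3 - x ^ 2 + x + 1 = 0"
proof -
  have "\<exists>x::real. -1 \<le> x \<and> x \<le> 0 \<and> x ^ 3 - x ^ 2 + x + 1 = 0"
    by (rule IVT') (auto intro!: continuous_intros)
  then obtain a :: real where a: "a ^ 3 - a ^ 2 + a + 1 = 0"
    by blast
  show ?thesis
  proof (rule ex1I[of _ a])
    fix b :: real
    assume b: "b ^ 3 - b ^ 2 + b + 1 = 0"
    have "(a - b) * ((a + b) ^ 2 + (a - 1) ^ 2 + (b - 1) ^ 2) = 0"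
      using a b by algebra
    moreover have "(a + b) ^ 2 + (a - 1) ^ 2 + (b - 1) ^ 2 \<noteq> 0"
      by (simp add: sum_power2_eq_zero_iff add_nonneg_eq_0_iff)
    ultimately show "b = a"
      by simp
  qed (rule a)
qed

text \<open>
  Sequences are indexed by the integers, but only the indices from \<open>-1\<close> on matter:
  the values at \<open>-1\<close> and \<open>0\<close> are the initial values. Since division by zero is
  \<open>0\<close> in HOL, the denominators are explicitly required not to vanish.
\<close>

definition solution :: "(int \<Rightarrow> real) \<Rightarrow> (int \<Rightarrow> real) \<Rightarrow> bool" where
  "solution x y \<longleftrightarrow>
     (\<forall>n\<ge>0. y n * (x (n - 1) - 1) + 1 \<noteq> 0 \<and>
            x n * (y (n - 1) - 1) + 1 \<noteq> 0 \<and>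
            x (n + 1) = -1 / (y n * (x (n - 1) - 1) + 1) \<and>
            y (n + 1) = -1 / (x n * (y (n - 1) - 1) + 1))"

definition equilibrium :: "real \<times> real \<Rightarrow> bool" where
  "equilibrium p \<longleftrightarrow> solution (\<lambda>_. fst p) (\<lambda>_. snd p)"

definition negative_equilibrium :: "real \<times> real \<Rightarrow> bool" where
  "negative_equilibrium p \<longleftrightarrow> equilibrium p \<and> fst p < 0 \<and> snd p < 0"

definition solution_from ::
  "real \<Rightarrow> real \<Rightarrow> real \<Rightarrow> real \<Rightarrow> (int \<Rightarrow> real) \<Rightarrow> (int \<Rightarrow> real) \<Rightarrow> bool" where
  "solution_from x1 x0 y1 y0 x y \<longleftrightarrow>
     solution x y \<and> x (-1) = x1 \<and> x 0 = x0 \<and> y (-1) = y1 \<and> y 0 = y0"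

text \<open>
  The initial values determine a solution from index \<open>-1\<close> on, so in the definitions below
  ``there is a solution with these initial values such that'' means
  ``the solution with these initial values is well defined and''.
\<close>

lemma solution_from_unique:
  assumes "solution_from x1 x0 y1 y0 x y" "solution_from x1 x0 y1 y0 x' y'" "n \<ge> 0"
  shows "x (n - 1) = x' (n - 1) \<and> y (n - 1) = y' (n - 1) \<and> x n = x' n \<and> y n = y' n"
  using assms(3)
proof (induction n rule: int_ge_induct)
  case base
  then show ?case using assms(1,2) by (simp add: solution_from_def)
next
  case (step n)
  then show ?case using assms(1,2) by (simp add: solution_from_def solution_def)
qed

definition stable :: "real \<times> real \<Rightarrow> bool" where
  "stable p \<longleftrightarrow>
     (\<forall>\<epsilon>>0. \<exists>\<delta>>0. \<forall>x1 x0 y1 y0.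
        \<bar>x1 - fst p\<bar> < \<delta> \<and> \<bar>x0 - fst p\<bar> < \<delta> \<and> \<bar>y1 - snd p\<bar> < \<delta> \<and> \<bar>y0 - snd p\<bar> < \<delta> \<longrightarrow>
        (\<exists>x y. solution_from x1 x0 y1 y0 x y \<and>
               (\<forall>n\<ge>0. \<bar>x n - fst p\<bar> < \<epsilon> \<and> \<bar>y n - snd p\<bar> < \<epsilon>)))"

definition locally_asymptotically_stable :: "real \<times> real \<Rightarrow> bool" where
  "locally_asymptotically_stable p \<longleftrightarrow>
     stable p \<and>
     (\<exists>\<gamma>>0. \<forall>x1 x0 y1 y0.
        \<bar>x1 - fst p\<bar> < \<gamma> \<and> \<bar>x0 - fst p\<bar> < \<gamma> \<and> \<bar>y1 - snd p\<bar> < \<gamma> \<and> \<bar>y0 - snd p\<bar> < \<gamma> \<longrightarrow>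
        (\<exists>x y. solution_from x1 x0 y1 y0 x y \<and>
               (\<lambda>n. (x (int n), y (int n))) \<longlonglongrightarrow> p))"

end

theory Submission
  imports Defs
begin

text \<open>
  At \<open>(d, d)\<close> the linearised system is \<open>u\<^sub>n\<^sub>+\<^sub>1 = d\<^sup>2 (d - 1) v\<^sub>n + d\<^sup>3 u\<^sub>n\<^sub>-\<^sub>1\<close> (and symmetrically), and
  \<open>\<bar>d\<^sup>2 (d - 1)\<bar> + \<bar>d\<^sup>3\<bar> \<approx> 0.62 < 1\<close>. Hence one step of the system shrinks the maximum norm of the
  deviations, and on the neighbourhood of radius \<open>1/10\<close> it does so explicitly by the factor \<open>4/5\<close>.
  As the recursion looks two steps back, the deviations decay like \<open>q ^ n\<close> for any \<open>q\<close> with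
  \<open>q\<^sup>2 \<ge> 4/5\<close>, such as \<open>q = 9/10\<close>.
\<close>

lemma d_cubic: "d ^ 3 - d ^ 2 + d + 1 = 0"
  unfolding d_def by (rule theI'[OF ex1_cubic_root])

lemma d_unique: "x ^ 3 - x ^ 2 + x + 1 = 0 \<Longrightarrow> x = d"
  using ex1_cubic_root d_cubic by blast

text \<open>With t = -d the cubic reads t^3 + t^2 + t = 1. The left side increases for t >= 0 and
  passes 1 between 27/50 and 11/20; this bound and \<open>d_upper\<close> supply the constants of
  \<open>step_contraction\<close>.\<close>

lemma d_lower: "- (11/20) < d"
proof (rule ccontr)
  assume "\<not> - (11/20) < d"
  then have le: "11/20 \<le> - d" by simp
  have "(11/20) ^ 2 \<le> (- d) ^ 2" "(11/20) ^ 3 \<le> (- d) ^ 3"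
    by (rule power_mono[OF le], simp)+
  with le d_cubic show False
    by (simp add: power_divide)
qed

lemma d_upper: "d < - (27/50)"
proof (rule ccontr)
  assume "\<not> d < - (27/50)"
  then have le: "- d \<le> 27/50" by simp
  show False
  proof (cases "d \<le> 0")
    case True
    have "(- d) ^ 2 \<le> (27/50) ^ 2" "(- d) ^ 3 \<le> (27/50) ^ 3"
      by (rule power_mono[OF le], use True in simp)+
    with le d_cubic show False
      by (simp add: power_divide)
  next
    case False
    \<comment> \<open>For d > 0, where powers of -d are not monotone, completing the square makes
      the cubic visibly positive.\<close>
    have "d ^ 3 - d ^ 2 + d + 1 = d * ((d - 1/2) ^ 2 + 3/4) + 1"
      by algebra
    moreover have "0 < d * ((d - 1/2) ^ 2 + 3/4)"
      using False by (intro mult_pos_pos) (auto intro: add_nonneg_pos)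
    ultimately show False using d_cubic by simp
  qed
qed

text \<open>Cardano's method: x = (1 + t) / 3 turns the cubic into t^3 + 6 t + 34 = 0, and t = a - b
  solves this as soon as a b = 2 and b^3 - a^3 = 34.\<close>

lemma d_cardano: "d = (1 + root 3 (3 * sqrt 33 - 17) - root 3 (3 * sqrt 33 + 17)) / 3"
proof -
  define a where "a = root 3 (3 * sqrt 33 - 17)"
  define b where "b = root 3 (3 * sqrt 33 + 17)"
  have a3: "a ^ 3 = 3 * sqrt 33 - 17" and b3: "b ^ 3 = 3 * sqrt 33 + 17"
    by (simp_all add: a_def b_def odd_real_root_pow)
  have "a * b = root 3 ((3 * sqrt 33 - 17) * (3 * sqrt 33 + 17))"
    by (simp add: a_def b_def real_root_mult)
  also have "(3 * sqrt 33 - 17) * (3 * sqrt 33 + 17) = (2::real) ^ 3"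
    by (simp add: algebra_simps)
  finally have ab: "a * b = 2"
    by (simp add: odd_real_root_power_cancel)
  have "(a - b) ^ 3 = a ^ 3 - b ^ 3 - 3 * (a * b) * (a - b)"
    by algebra
  then have t: "(a - b) ^ 3 + 6 * (a - b) + 34 = 0"
    by (simp add: a3 b3 ab)
  define x where "x = (1 + a - b) / 3"
  have "a - b = 3 * x - 1" by (simp add: x_def field_simps)
  with t have "(3 * x - 1) ^ 3 + 6 * (3 * x - 1) + 34 = 0" by simp
  moreover have "(3 * x - 1) ^ 3 + 6 * (3 * x - 1) + 34 = 27 * (x ^ 3 - x ^ 2 + x + 1)"
    by algebra
  ultimately have "x ^ 3 - x ^ 2 + x + 1 = 0" by simp
  from d_unique[OF this] show ?thesis
    by (simp add: x_def a_def b_def)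
qed

text \<open>Clearing denominators loses nothing: a product equal to -1 has no zero factor.\<close>

lemma equilibrium_iff:
  "equilibrium (x, y) \<longleftrightarrow> x * (y * (x - 1) + 1) = - 1 \<and> y * (x * (y - 1) + 1) = - 1"
proof -
  have "D \<noteq> 0 \<and> z = - 1 / D \<longleftrightarrow> z * D = - 1" for z D :: real
    by (metis nonzero_eq_divide_eq mult_zero_right zero_neq_neg_one)
  from this[of "y * (x - 1) + 1" x] this[of "x * (y - 1) + 1" y] show ?thesis
    unfolding equilibrium_def solution_def by auto
qed

lemma negative_equilibrium_iff: "negative_equilibrium p \<longleftrightarrow> p = (d, d)"
proof
  assume neg: "negative_equilibrium p"
  obtain x y where p: "p = (x, y)" by (cases p)
  have xy: "x < 0" "y < 0"
    and eq: "x * (y * (x - 1) + 1) = - 1" "y * (x * (y - 1) + 1) = - 1"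
    using neg by (auto simp: negative_equilibrium_def p equilibrium_iff)
  \<comment> \<open>This is the difference of the two equations. Negativity gives x y > 0, which
    forces the point onto the diagonal, where either equation is the cubic.\<close>
  have "(x - y) * (x * y + 1) = 0"
    using eq by algebra
  moreover have "0 < x * y + 1"
    using xy by (simp add: mult_neg_neg add_pos_pos)
  ultimately have "x = y" by simp
  have "x ^ 3 - x ^ 2 + x + 1 = 0"
    using eq(1) unfolding \<open>x = y\<close> by algebra
  then show "p = (d, d)"
    using d_unique \<open>x = y\<close> p by simp
next
  assume "p = (d, d)"
  moreover have "d * (d * (d - 1) + 1) = - 1"
    using d_cubic by algebra
  ultimately show "negative_equilibrium p"
    using d_upper by (simp add: negative_equilibrium_def equilibrium_iff)
qed

lemma step_contraction:
  fixes x y m :: real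
  assumes "\<bar>x - d\<bar> \<le> m" "\<bar>y - d\<bar> \<le> m" "m \<le> 1/10"
  shows "0 < y * (x - 1) + 1" and "\<bar>- 1 / (y * (x - 1) + 1) - d\<bar> \<le> 4/5 * m"
proof -
  define D where "D = y * (x - 1) + 1"
  have "0 \<le> m" using assms(1) by simp
  \<comment> \<open>Both x and y lie below -27/50 + 1/10 = -11/25.\<close>
  have "(11/25) * (36/25) \<le> (- y) * (1 - x)"
    using assms d_upper by (intro mult_mono) auto
  then have D: "163/100 \<le> D"
    by (simp add: D_def algebra_simps)
  then show "0 < y * (x - 1) + 1" by (simp add: D_def)
  \<comment> \<open>By the cubic, -1 = d * D0 with D0 the denominator at (d, d), so the left side is
    d * (D - D0), which is linear in the deviations up to the factor x - 1.\<close>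
  have "1 + d * D = d * ((y - d) * (x - 1) + d * (x - d))"
    using d_cubic unfolding D_def by algebra
  then have "- 1 / D - d = - d * ((y - d) * (x - 1) + d * (x - d)) / D"
    using D by (simp add: field_simps)
  then have "\<bar>- 1 / D - d\<bar> = \<bar>d\<bar> * \<bar>(y - d) * (x - 1) + d * (x - d)\<bar> / D"
    using D by (simp add: abs_mult)
  \<comment> \<open>Here 11/5 = 33/20 + 11/20, where |x - 1| <= 33/20 follows from x > -13/20. The
    quotient is about 0.742 m.\<close>
  also have "\<dots> \<le> (11/20) * (11/5 * m) / (163/100)"
  proof (intro frac_le mult_mono)
    have "\<bar>(y - d) * (x - 1) + d * (x - d)\<bar> \<le> \<bar>y - d\<bar> * \<bar>x - 1\<bar> + \<bar>d\<bar> * \<bar>x - d\<bar>"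
      by (metis abs_mult abs_triangle_ineq)
    also have "\<dots> \<le> m * (33/20) + (11/20) * m"
      using assms d_lower d_upper \<open>0 \<le> m\<close> by (intro add_mono mult_mono) auto
    finally show "\<bar>(y - d) * (x - 1) + d * (x - d)\<bar> \<le> 11/5 * m" by simp
  qed (use D d_lower d_upper \<open>0 \<le> m\<close> in auto)
  also have "\<dots> \<le> 4/5 * m" using \<open>0 \<le> m\<close> by simp
  finally show "\<bar>- 1 / (y * (x - 1) + 1) - d\<bar> \<le> 4/5 * m" by (simp add: D_def)
qed

text \<open>The \<open>n\<close>-th state is \<open>(x\<^sub>n\<^sub>-\<^sub>1, x\<^sub>n, y\<^sub>n\<^sub>-\<^sub>1, y\<^sub>n)\<close>.\<close>

definition next_state :: "real \<times> real \<times> real \<times> real \<Rightarrow> real \<times> real \<times> real \<times> real" where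
  "next_state = (\<lambda>(x1, x0, y1, y0).
     (x0, - 1 / (y0 * (x1 - 1) + 1), y0, - 1 / (x0 * (y1 - 1) + 1)))"

text \<open>Gives stability and attraction at once. The initial radius is 9/10 * M because the
  values at index 0 must already satisfy the bound with exponent 1.\<close>

lemma exists_decaying_solution:
  assumes M: "0 < M" "M \<le> 1/10"
    and init: "\<bar>x1 - d\<bar> < 9/10 * M" "\<bar>x0 - d\<bar> < 9/10 * M"
      "\<bar>y1 - d\<bar> < 9/10 * M" "\<bar>y0 - d\<bar> < 9/10 * M"
  shows "\<exists>x y. solution_from x1 x0 y1 y0 x y \<and>
    (\<forall>n. \<bar>x (int n) - d\<bar> \<le> M * (9/10) ^ Suc n \<and> \<bar>y (int n) - d\<bar> \<le> M * (9/10) ^ Suc n)"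
proof -
  define s where "s n = (next_state ^^ n) (x1, x0, y1, y0)" for n
  \<comment> \<open>Indices are shifted by one: \<open>a n\<close> and \<open>b n\<close> stand for
    the terms of index n - 1.\<close>
  define a where "a n = fst (s n)" for n
  define b where "b n = fst (snd (snd (s n)))" for n
  have s0: "s 0 = (x1, x0, y1, y0)" and s_Suc: "s (Suc n) = next_state (s n)" for n
    by (simp_all add: s_def)
  have s_eq: "s n = (a n, a (Suc n), b n, b (Suc n))" for n
    by (cases "s n") (simp add: a_def b_def s_Suc next_state_def)
  have rec: "a (Suc (Suc n)) = - 1 / (b (Suc n) * (a n - 1) + 1)"
    "b (Suc (Suc n)) = - 1 / (a (Suc n) * (b n - 1) + 1)" for n
    using s_Suc[of n] unfolding s_eq by (simp_all add: next_state_def)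
  have init_ab: "a 0 = x1" "a (Suc 0) = x0" "b 0 = y1" "b (Suc 0) = y0"
    using s0 s_eq[of 0] by simp_all
  define c where "c n = M * (9/10) ^ n" for n
  have c_le: "c n \<le> 1/10" for n
  proof -
    have "M * (9/10) ^ n \<le> M * 1"
      using M by (intro mult_left_mono power_le_one) auto
    also have "\<dots> \<le> 1/10" using M by simp
    finally show ?thesis by (simp add: c_def)
  qed
  have c_pos: "0 < c n" for n using M by (simp add: c_def)
  have c_Suc: "c (Suc n) = 9/10 * c n" for n by (simp add: c_def)
  have bound: "\<bar>a n - d\<bar> \<le> c n \<and> \<bar>b n - d\<bar> \<le> c n \<and>
      \<bar>a (Suc n) - d\<bar> \<le> c (Suc n) \<and> \<bar>b (Suc n) - d\<bar> \<le> c (Suc n)" for n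
  proof (induction n)
    case 0
    then show ?case using init M by (simp add: init_ab c_def)
  next
    case (Suc n)
    have le: "\<bar>a (Suc n) - d\<bar> \<le> c n" "\<bar>b (Suc n) - d\<bar> \<le> c n"
      using Suc c_pos[of n] by (auto simp: c_Suc)
    have "\<bar>a (Suc (Suc n)) - d\<bar> \<le> 4/5 * c n"
      unfolding rec by (rule step_contraction) (use Suc le c_le in auto)
    moreover have "\<bar>b (Suc (Suc n)) - d\<bar> \<le> 4/5 * c n"
      unfolding rec by (rule step_contraction) (use Suc le c_le in auto)
    \<comment> \<open>The decay rate closes the induction: 4/5 <= (9/10)^2, so 4/5 * c n is at most
      \<open>c (Suc (Suc n))\<close>.\<close>
    ultimately show ?case
      using Suc c_pos[of n] by (auto simp: c_Suc)
  qed
  have denom: "b (Suc n) * (a n - 1) + 1 \<noteq> 0" "a (Suc n) * (b n - 1) + 1 \<noteq> 0" for n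
  proof -
    have le: "\<bar>a (Suc n) - d\<bar> \<le> c n" "\<bar>b (Suc n) - d\<bar> \<le> c n"
      using bound[of n] c_pos[of n] by (auto simp: c_Suc)
    show "b (Suc n) * (a n - 1) + 1 \<noteq> 0"
      using step_contraction(1)[of "a n" "c n" "b (Suc n)"] bound[of n] le c_le by force
    show "a (Suc n) * (b n - 1) + 1 \<noteq> 0"
      using step_contraction(1)[of "b n" "c n" "a (Suc n)"] bound[of n] le c_le by force
  qed
  define x where "x k = a (nat (k + 1))" for k :: int
  define y where "y k = b (nat (k + 1))" for k :: int
  have "solution x y"
    unfolding solution_def
  proof (intro allI impI)
    fix k :: int
    assume "0 \<le> k"
    then obtain n where k: "k = int n" using nonneg_int_cases by blast
    have "x (k - 1) = a n" "x k = a (Suc n)" "x (k + 1) = a (Suc (Suc n))"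
      "y (k - 1) = b n" "y k = b (Suc n)" "y (k + 1) = b (Suc (Suc n))"
      by (simp_all add: x_def y_def k nat_add_distrib)
    then show "y k * (x (k - 1) - 1) + 1 \<noteq> 0 \<and> x k * (y (k - 1) - 1) + 1 \<noteq> 0 \<and>
        x (k + 1) = - 1 / (y k * (x (k - 1) - 1) + 1) \<and>
        y (k + 1) = - 1 / (x k * (y (k - 1) - 1) + 1)"
      using denom[of n] rec[of n] by simp
  qed
  then have "solution_from x1 x0 y1 y0 x y"
    using init_ab by (simp add: solution_from_def x_def y_def)
  moreover have "x (int n) = a (Suc n)" "y (int n) = b (Suc n)" for n
    by (simp_all add: x_def y_def nat_add_distrib)
  ultimately show ?thesis
    using bound unfolding c_def by metis
qed

lemma stable_d: "stable (d, d)"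
  unfolding stable_def fst_conv snd_conv
proof (intro allI impI)
  fix \<epsilon> :: real
  assume "\<epsilon> > 0"
  \<comment> \<open>The cap 1/10 keeps the orbit where the contraction estimate holds.\<close>
  define M where "M = min \<epsilon> (1/10)"
  have M: "0 < M" "M \<le> 1/10" "M \<le> \<epsilon>" using \<open>\<epsilon> > 0\<close> by (auto simp: M_def)
  have lt: "M * (9/10) ^ Suc n < \<epsilon>" for n
  proof -
    have "M * (9/10) ^ Suc n < M * 1"
      using M by (intro mult_strict_left_mono power_Suc_less_one) auto
    also have "\<dots> \<le> \<epsilon>" using M by simp
    finally show ?thesis .
  qed
  show "\<exists>\<delta>>0. \<forall>x1 x0 y1 y0.
      \<bar>x1 - d\<bar> < \<delta> \<and> \<bar>x0 - d\<bar> < \<delta> \<and> \<bar>y1 - d\<bar> < \<delta> \<and> \<bar>y0 - d\<bar> < \<delta> \<longrightarrow>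
      (\<exists>x y. solution_from x1 x0 y1 y0 x y \<and> (\<forall>n\<ge>0. \<bar>x n - d\<bar> < \<epsilon> \<and> \<bar>y n - d\<bar> < \<epsilon>))"
  proof (intro exI[of _ "9/10 * M"] conjI allI impI)
    fix x1 x0 y1 y0
    assume "\<bar>x1 - d\<bar> < 9/10 * M \<and> \<bar>x0 - d\<bar> < 9/10 * M \<and> \<bar>y1 - d\<bar> < 9/10 * M \<and> \<bar>y0 - d\<bar> < 9/10 * M"
    then obtain x y where sol: "solution_from x1 x0 y1 y0 x y"
      and bd: "\<And>n. \<bar>x (int n) - d\<bar> \<le> M * (9/10) ^ Suc n"
        "\<And>n. \<bar>y (int n) - d\<bar> \<le> M * (9/10) ^ Suc n"
      using exists_decaying_solution[OF M(1,2)] by blast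
    have "\<bar>x n - d\<bar> < \<epsilon> \<and> \<bar>y n - d\<bar> < \<epsilon>" if "0 \<le> n" for n
      using bd[of "nat n"] lt[of "nat n"] that by simp
    with sol show "\<exists>x y. solution_from x1 x0 y1 y0 x y \<and>
        (\<forall>n\<ge>0. \<bar>x n - d\<bar> < \<epsilon> \<and> \<bar>y n - d\<bar> < \<epsilon>)" by blast
  qed (use M in simp)
qed

lemma locally_asymptotically_stable_d: "locally_asymptotically_stable (d, d)"
  unfolding locally_asymptotically_stable_def fst_conv snd_conv
\<comment> \<open>The radius 9/100 is 9/10 * M for the largest admissible M = 1/10.\<close>
proof (intro conjI stable_d exI[of _ "9/100"] allI impI)
  fix x1 x0 y1 y0
  assume "\<bar>x1 - d\<bar> < 9/100 \<and> \<bar>x0 - d\<bar> < 9/100 \<and> \<bar>y1 - d\<bar> < 9/100 \<and> \<bar>y0 - d\<bar> < 9/100"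
  then obtain x y where sol: "solution_from x1 x0 y1 y0 x y"
    and bd: "\<And>n. \<bar>x (int n) - d\<bar> \<le> 1/10 * (9/10) ^ Suc n"
      "\<And>n. \<bar>y (int n) - d\<bar> \<le> 1/10 * (9/10) ^ Suc n"
    using exists_decaying_solution[of "1/10" x1 x0 y1 y0] by auto
  have "(\<lambda>n. (9/10::real) ^ Suc n) \<longlonglongrightarrow> 0"
    by (intro LIMSEQ_Suc LIMSEQ_realpow_zero) auto
  then have lim: "(\<lambda>n. 1/10 * (9/10::real) ^ Suc n) \<longlonglongrightarrow> 0"
    by (rule tendsto_mult_right_zero)
  have "(\<lambda>n. z (int n)) \<longlonglongrightarrow> d"
    if "\<And>n. \<bar>z (int n) - d\<bar> \<le> 1/10 * (9/10) ^ Suc n" for z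
    using that by (intro LIM_zero_cancel[OF Lim_null_comparison[OF _ lim]]) (auto simp del: power_Suc)
  then have "(\<lambda>n. (x (int n), y (int n))) \<longlonglongrightarrow> (d, d)"
    using bd by (intro tendsto_Pair) blast+
  with sol show "\<exists>x y. solution_from x1 x0 y1 y0 x y \<and>
      (\<lambda>n. (x (int n), y (int n))) \<longlonglongrightarrow> (d, d)" by blast
qed simp

theorem theorem9:
  shows "d = (1 + root 3 (3 * sqrt 33 - 17) - root 3 (3 * sqrt 33 + 17)) / 3 \<and>
         (\<exists>!p. negative_equilibrium p) \<and>
         negative_equilibrium (d, d) \<and>
         locally_asymptotically_stable (d, d)"
  using d_cardano locally_asymptotically_stable_d by (simp add: negative_equilibrium_iff)

end
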